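(* Let $d$ be either $0$ or a positive square-free integer, $K=\mathbb{Q}(\sqrt{-d})$, $R$ the ring of integers of $K$. (a) $\omega(\Gamma_{1,n})=2$ for all $n\geq1$. (b) $\omega(\Gamma^{un}_{2,n})=2n+1$ for all $n\geq1$.
   Context: $\omega(\cdot)$ denotes the clique number of a graph. The zero-divisor graph $\Gamma(M_2(R))$ is the directed graph whose vertices are the nonzero (left or right) zero-divisors of $M_2(R)$, with an edge $v_1\to v_2$ between distinct vertices iff $v_1v_2=0$. For an integer $N\geq1$ and $t\in R$, let $S_{tc,1,t,N}=\{\lambda\begin{bmatrix}1&t\\t^2&t^3\end{bmatrix}:\lambda\in\mathbb{Z},\,1\leq|\lambda|\leq N\}$ and $S_{tc,2,N}=\{\begin{bmatrix}0&0\\0&\lambda\end{bmatrix}:\lambda\in\mathbb{Z},\,1\leq|\lambda|\leq N\}$. Let $\Gamma_{1,N}$ be the induced subgraph of $\Gamma(M_2(R))$ on $S_{tc,1,0,N}\cup S_{tc,2,N}$, regarded as an undirected graph. Let $U=\{\pm1\}$ if $d\neq1,3$, $U=\{\pm1,\pm i\}$ if $d=1$ ($i=\sqrt{-1}$), $U=\{\pm1,\pm\zeta,\pm\zeta^2\}$ if $d=3$ ($\zeta$ a primitive third root of unity); let $\Gamma_{2,N}$ be the induced subgraph of $\Gamma(M_2(R))$ on $\bigcup_{j\in U}S_{tc,1,j,N}$, and $\Gamma^{un}_{2,N}$ its underlying undirected graph (distinct $v_1,v_2$ adjacent iff $v_1v_2=0$ or $v_2v_1=0$). *)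

theory Defs
  imports
    "HOL-Analysis.Analysis"
    "HOL-Computational_Algebra.Polynomial"
    "HOL-Computational_Algebra.Squarefree"
    "HOL-Library.Extended_Nat"
    "Graph_Theory.Digraph_Component"
begin

definition is_subfield :: "'a::field set \<Rightarrow> bool" where
  "is_subfield F \<longleftrightarrow> 0 \<in> F \<and> 1 \<in> F \<and>
     (\<forall>x\<in>F. \<forall>y\<in>F. x + y \<in> F \<and> x * y \<in> F) \<and> (\<forall>x\<in>F. - x \<in> F \<and> inverse x \<in> F)"

definition imag_quadratic_field :: "nat \<Rightarrow> complex set" where
  "imag_quadratic_field d = \<Inter> {F. is_subfield F \<and> csqrt (- of_nat d) \<in> F}"

definition ring_of_integers :: "'a::field set \<Rightarrow> 'a set" where
  "ring_of_integers K = {x \<in> K. algebraic_int x}"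

definition primitive_root_unity :: "nat \<Rightarrow> 'a::monoid_mult \<Rightarrow> bool" where
  "primitive_root_unity m z \<longleftrightarrow> 0 < m \<and> z ^ m = 1 \<and> (\<forall>k. 0 < k \<and> k < m \<longrightarrow> z ^ k \<noteq> 1)"

definition mat2 :: "'a::zero \<Rightarrow> 'a \<Rightarrow> 'a \<Rightarrow> 'a \<Rightarrow> 'a^2^2" where
  "mat2 a b c d = vector [vector [a, b], vector [c, d]]"

definition matrices2 :: "'a set \<Rightarrow> ('a^2^2) set" where
  "matrices2 R = {A. \<forall>i j. A $ i $ j \<in> R}"

definition M2_zero_divisors :: "'a::ring_1 set \<Rightarrow> ('a^2^2) set" where
  "M2_zero_divisors R =
     {A \<in> matrices2 R. A \<noteq> 0 \<and> (\<exists>B\<in>matrices2 R. B \<noteq> 0 \<and> (A ** B = 0 \<or> B ** A = 0))}"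

definition zero_divisor_graph :: "'a::ring_1 set \<Rightarrow> ('a^2^2) pair_pre_digraph" where
  "zero_divisor_graph R =
     \<lparr> pverts = M2_zero_divisors R,
       parcs = {(A, B). A \<in> M2_zero_divisors R \<and> B \<in> M2_zero_divisors R \<and>
                        A \<noteq> B \<and> A ** B = 0} \<rparr>"

definition S_tc1 :: "complex \<Rightarrow> nat \<Rightarrow> (complex^2^2) set" where
  "S_tc1 t N = {of_int l *\<^sub>R mat2 1 t (t^2) (t^3) | l :: int. 1 \<le> \<bar>l\<bar> \<and> \<bar>l\<bar> \<le> int N}"

definition S_tc2 :: "nat \<Rightarrow> (complex^2^2) set" where
  "S_tc2 N = {mat2 0 0 0 (of_int l) | l :: int. 1 \<le> \<bar>l\<bar> \<and> \<bar>l\<bar> \<le> int N}"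

definition U_set :: "nat \<Rightarrow> complex \<Rightarrow> complex set" where
  "U_set d \<zeta> =
     (if d = 1 then {1, -1, \<i>, - \<i>}
      else if d = 3 then {1, -1, \<zeta>, - \<zeta>, \<zeta>^2, - (\<zeta>^2)}
      else {1, -1})"

definition Gamma1 :: "nat \<Rightarrow> nat \<Rightarrow> (complex^2^2, (complex^2^2) \<times> (complex^2^2)) pre_digraph" where
  "Gamma1 d N =
     induce_subgraph (zero_divisor_graph (ring_of_integers (imag_quadratic_field d)))
       (S_tc1 0 N \<union> S_tc2 N)"

definition Gamma2 ::
  "nat \<Rightarrow> complex \<Rightarrow> nat \<Rightarrow> (complex^2^2, (complex^2^2) \<times> (complex^2^2)) pre_digraph" where
  "Gamma2 d \<zeta> N =
     induce_subgraph (zero_divisor_graph (ring_of_integers (imag_quadratic_field d)))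
       (\<Union>j\<in>U_set d \<zeta>. S_tc1 j N)"

text \<open>Undirected graphs are symmetric digraphs; \<^const>\<open>mk_symmetric\<close> gives the underlying
  undirected graph of a digraph. The clique number takes values in \<^typ>\<open>enat\<close>, so that it is
  \<open>\<infinity>\<close> for graphs with arbitrarily large finite cliques.\<close>

definition is_clique :: "('a, 'b) pre_digraph \<Rightarrow> 'a set \<Rightarrow> bool" where
  "is_clique G C \<longleftrightarrow> C \<subseteq> verts G \<and> (\<forall>u\<in>C. \<forall>v\<in>C. u \<noteq> v \<longrightarrow> (u, v) \<in> arcs_ends G)"

definition clique_number :: "('a, 'b) pre_digraph \<Rightarrow> enat" where
  "clique_number G = Sup {enat (card C) | C. finite C \<and> is_clique G C}"

end

theory Submission
  imports Defs
begin

text \<open>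
  The entries of a multiple of the matrix with parameter \<open>t\<close> are proportional to the point
  \<open>(1, t, t\<^sup>2, t\<^sup>3)\<close> of the twisted cubic, and the matrix is the product of a multiple of the
  column \<open>(1, t\<^sup>2)\<close> and the row \<open>(1, t)\<close>, so the product of a matrix with parameter \<open>s\<close> and one
  with parameter \<open>t\<close> vanishes iff \<open>s t\<^sup>2 = -1\<close>. Hence the multiples with parameter \<open>t\<close> form a
  clique if \<open>t\<^sup>3 = -1\<close> and an independent set otherwise, and a clique meets an independent set
  in at most one vertex. This bounds the cliques of the first graph, which is covered by two
  independent sets. In the second graph, if \<open>t\<^sup>3 = -1\<close> then every neighbour of a matrix with
  parameter \<open>t\<close> has parameter \<open>t\<close> or \<open>-t\<close>, so a clique containing such a matrix consists of at
  most \<open>2n\<close> multiples with parameter \<open>t\<close> and at most one with parameter \<open>-t\<close>; any other clique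
  is covered by the independent sets for the at most three \<open>t \<in> U\<close> with \<open>t\<^sup>3 \<noteq> -1\<close>. The bound is
  attained by the multiples with parameter \<open>-1\<close> together with one matrix with parameter \<open>1\<close>.
\<close>

subsection \<open>Integers in number fields\<close>

lemma Ints_subset_subfield:
  assumes "is_subfield F"
  shows "\<int> \<subseteq> F"
proof -
  have of_nat: "of_nat k \<in> F" for k
    using assms by (induction k) (auto simp: is_subfield_def)
  have "of_int m \<in> F" for m
    using assms of_nat by (cases m rule: int_cases2) (auto simp: is_subfield_def)
  then show ?thesis
    by (auto elim: Ints_cases)
qed

lemma is_subfield_Inter: "(\<And>F. F \<in> \<F> \<Longrightarrow> is_subfield F) \<Longrightarrow> is_subfield (\<Inter>\<F>)"
  by (simp add: is_subfield_def)

lemma is_subfield_imag_quadratic_field: "is_subfield (imag_quadratic_field d)"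
  unfolding imag_quadratic_field_def by (rule is_subfield_Inter) simp

lemma Ints_subset_ring_of_integers: "is_subfield K \<Longrightarrow> \<int> \<subseteq> ring_of_integers K"
  using Ints_subset_subfield by (auto simp: ring_of_integers_def elim: Ints_cases)

subsection \<open>Cliques and independent sets\<close>

definition is_independent :: "('a, 'b) pre_digraph \<Rightarrow> 'a set \<Rightarrow> bool" where
  "is_independent G I \<longleftrightarrow> (\<forall>u\<in>I. \<forall>v\<in>I. u \<noteq> v \<longrightarrow> (u, v) \<notin> arcs_ends G)"

lemma card_clique_Int_independent_le_1:
  assumes "is_clique G C" "is_independent G I"
  shows "card (C \<inter> I) \<le> 1"
proof -
  have "\<forall>u\<in>C \<inter> I. \<forall>v\<in>C \<inter> I. u = v"
    using assms unfolding is_clique_def is_independent_def by blast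
  then show ?thesis
    by (cases "finite (C \<inter> I)") (simp_all add: card_le_Suc0_iff_eq)
qed

lemma card_clique_le_card_independent_cover:
  assumes "is_clique G C" "finite \<I>" "C \<subseteq> \<Union>\<I>"
    and "\<And>I. I \<in> \<I> \<Longrightarrow> is_independent G I"
  shows "card C \<le> card \<I>"
proof -
  have "C = (\<Union>I\<in>\<I>. C \<inter> I)"
    using assms(3) by blast
  then have "card C \<le> (\<Sum>I\<in>\<I>. card (C \<inter> I))"
    using card_UN_le[OF assms(2), of "\<lambda>I. C \<inter> I"] by simp
  also have "\<dots> \<le> (\<Sum>I\<in>\<I>. 1)"
    using assms(1,4) by (intro sum_mono card_clique_Int_independent_le_1)
  finally show ?thesis
    by simp
qed

lemma clique_number_eqI:
  assumes "finite C" "is_clique G C" "card C = k"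
    and "\<And>D. finite D \<Longrightarrow> is_clique G D \<Longrightarrow> card D \<le> k"
  shows "clique_number G = enat k"
proof (rule antisym)
  show "clique_number G \<le> enat k"
    using assms(4) unfolding clique_number_def by (auto intro!: Sup_least)
  show "enat k \<le> clique_number G"
    using assms(1-3) unfolding clique_number_def by (auto intro!: Sup_upper)
qed

subsection \<open>Two-by-two matrices\<close>

lemma mat2_nth [simp]:
  "mat2 a b c d $ 1 $ 1 = a" "mat2 a b c d $ 1 $ 2 = b"
  "mat2 a b c d $ 2 $ 1 = c" "mat2 a b c d $ 2 $ 2 = d"
  by (simp_all add: mat2_def)

lemma mat2_eq_iff: "mat2 a b c d = mat2 a' b' c' d' \<longleftrightarrow> a = a' \<and> b = b' \<and> c = c' \<and> d = d'"
  by (auto simp: vec_eq_iff forall_2)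

lemma mat2_eq_0_iff [simp]: "mat2 a b c d = 0 \<longleftrightarrow> a = 0 \<and> b = 0 \<and> c = 0 \<and> d = 0"
  by (auto simp: vec_eq_iff forall_2)

lemma mat2_mult:
  fixes a :: "'a::semiring_1"
  shows "mat2 a b c d ** mat2 a' b' c' d' =
    mat2 (a * a' + b * c') (a * b' + b * d') (c * a' + d * c') (c * b' + d * d')"
  by (simp add: vec_eq_iff forall_2 matrix_matrix_mult_def sum_2)

lemma mat2_in_matrices2_iff:
  "mat2 a b c d \<in> matrices2 R \<longleftrightarrow> a \<in> R \<and> b \<in> R \<and> c \<in> R \<and> d \<in> R"
  by (auto simp: matrices2_def forall_2)

lemma matrices2_mono: "R \<subseteq> S \<Longrightarrow> matrices2 R \<subseteq> matrices2 S"
  by (auto simp: matrices2_def)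

subsection \<open>Undirected zero-divisor graphs\<close>

text \<open>All of \<open>V\<close> are vertices, because \<^const>\<open>induce_subgraph\<close> does not intersect \<open>V\<close> with the
  vertices of the graph: matrices in \<open>V\<close> that are not zero-divisors are isolated.\<close>

definition zero_divisor_ugraph ::
  "'a::ring_1 set \<Rightarrow> ('a^2^2) set \<Rightarrow> ('a^2^2, ('a^2^2) \<times> ('a^2^2)) pre_digraph" where
  "zero_divisor_ugraph R V =
     with_proj (mk_symmetric (induce_subgraph (with_proj (zero_divisor_graph R)) V))"

lemma verts_zero_divisor_ugraph [simp]: "verts (zero_divisor_ugraph R V) = V"
  by (simp add: zero_divisor_ugraph_def mk_symmetric_def)

lemma adj_zero_divisor_ugraph_iff:
  "(A, B) \<in> arcs_ends (zero_divisor_ugraph R V) \<longleftrightarrow>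
     A \<in> V \<and> B \<in> V \<and> A \<noteq> B \<and> A \<in> matrices2 R - {0} \<and> B \<in> matrices2 R - {0} \<and>
     (A ** B = 0 \<or> B ** A = 0)"
  unfolding zero_divisor_ugraph_def
  by (fastforce simp: mk_symmetric_def arcs_ends_def arc_to_ends_def zero_divisor_graph_def
      M2_zero_divisors_def)

subsection \<open>The cone over the twisted cubic\<close>

definition tc_mat :: "'a::idom \<Rightarrow> 'a \<Rightarrow> 'a^2^2" where
  "tc_mat t c = mat2 c (c * t) (c * t^2) (c * t^3)"

lemma tc_mat_eq_iff: "c \<noteq> 0 \<Longrightarrow> tc_mat s c = tc_mat t c' \<longleftrightarrow> s = t \<and> c = c'"
  by (auto simp: tc_mat_def mat2_eq_iff)

lemma tc_mat_eq_0_iff [simp]: "tc_mat t c = 0 \<longleftrightarrow> c = 0"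
  by (auto simp: tc_mat_def)

lemma tc_mat_mult_eq_0_iff:
  assumes "c \<noteq> 0" "c' \<noteq> 0"
  shows "tc_mat s c ** tc_mat t c' = 0 \<longleftrightarrow> s * t^2 = -1"
proof -
  define k where "k = c * c' * (1 + s * t^2)"
  have "tc_mat s c ** tc_mat t c' = mat2 k (k * t) (k * s^2) (k * (s^2 * t))"
    by (simp add: k_def tc_mat_def mat2_mult mat2_eq_iff algebra_simps power2_eq_square
        power3_eq_cube)
  then have "tc_mat s c ** tc_mat t c' = 0 \<longleftrightarrow> k = 0"
    by auto
  also have "\<dots> \<longleftrightarrow> s * t^2 = -1"
    using assms by (simp add: k_def add_eq_0_iff)
  finally show ?thesis .
qed

lemma eq_or_eq_minus_if_mult_square_eq:
  fixes s t :: "'a::idom"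
  assumes "t^3 = -1" and "s * t^2 = -1 \<or> t * s^2 = -1"
  shows "s = t \<or> s = -t"
proof -
  have "t \<noteq> 0"
    using assms(1) by auto
  have "s * t^2 = t * t^2 \<or> t * s^2 = t * t^2"
    using assms by (simp add: power2_eq_square power3_eq_cube mult.assoc)
  then have "s = t \<or> s^2 = t^2"
    using \<open>t \<noteq> 0\<close> by simp
  then show ?thesis
    by (auto simp: power2_eq_iff)
qed

lemma S_tc1_eq_image: "S_tc1 t N = (\<lambda>l. tc_mat t (of_int l)) ` ({- int N..int N} - {0})"
proof -
  have "of_int l *\<^sub>R mat2 1 t (t^2) (t^3) = tc_mat t (of_int l)" for l :: int
    by (simp add: vec_eq_iff forall_2 tc_mat_def scaleR_conv_of_real[where 'a = complex])
  moreover have "{l. 1 \<le> \<bar>l\<bar> \<and> \<bar>l\<bar> \<le> int N} = {- int N..int N} - {0}"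
    by auto
  ultimately show ?thesis
    by (simp add: S_tc1_def setcompr_eq_image)
qed

lemma finite_S_tc1: "finite (S_tc1 t N)"
  by (simp add: S_tc1_eq_image)

lemma card_S_tc1: "card (S_tc1 t N) = 2 * N"
proof -
  have "inj_on (\<lambda>l. tc_mat t (of_int l :: complex)) ({- int N..int N} - {0})"
    by (auto intro!: inj_onI simp: tc_mat_eq_iff)
  then show ?thesis
    by (simp add: S_tc1_eq_image card_image)
qed

lemma tc_mat_1_in_S_tc1: "n \<ge> 1 \<Longrightarrow> tc_mat t 1 \<in> S_tc1 t n"
  by (force simp: S_tc1_eq_image)

lemma disjoint_S_tc1: "s \<noteq> t \<Longrightarrow> S_tc1 s m \<inter> S_tc1 t n = {}"
  by (auto simp: S_tc1_eq_image tc_mat_eq_iff)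

lemma S_tc1_subset_matrices2:
  assumes "\<int> \<subseteq> R" "t \<in> \<int>"
  shows "S_tc1 t n \<subseteq> matrices2 R - {0}"
proof -
  have "S_tc1 t n \<subseteq> matrices2 \<int> - {0}"
    using assms(2) by (auto simp: S_tc1_eq_image) (simp add: tc_mat_def mat2_in_matrices2_iff)
  then show ?thesis
    using matrices2_mono[OF assms(1)] by blast
qed

lemma S_tc1_mult_eq_0_iff:
  "A \<in> S_tc1 s m \<Longrightarrow> B \<in> S_tc1 t n \<Longrightarrow> A ** B = 0 \<longleftrightarrow> s * t^2 = -1"
  by (auto simp: S_tc1_eq_image tc_mat_mult_eq_0_iff)

lemma adj_S_tc1D:
  assumes "(A, B) \<in> arcs_ends (zero_divisor_ugraph R V)" "A \<in> S_tc1 s m" "B \<in> S_tc1 t n"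
  shows "s * t^2 = -1 \<or> t * s^2 = -1"
  using assms by (simp add: adj_zero_divisor_ugraph_iff S_tc1_mult_eq_0_iff)

lemma is_independent_S_tc1:
  assumes "t^3 \<noteq> -1"
  shows "is_independent (zero_divisor_ugraph R V) (S_tc1 t n)"
proof -
  have "t * t^2 \<noteq> -1"
    using assms by (simp add: power2_eq_square power3_eq_cube mult.assoc)
  then show ?thesis
    unfolding is_independent_def using adj_S_tc1D by blast
qed

subsection \<open>Clique numbers\<close>

lemma is_independent_S_tc2: "is_independent (zero_divisor_ugraph R V) (S_tc2 n)"
  by (auto simp: is_independent_def adj_zero_divisor_ugraph_iff S_tc2_def mat2_mult)

lemma clique_number_S_tc1_0_Un_S_tc2:
  assumes "\<int> \<subseteq> R" "n \<ge> 1"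
  shows "clique_number (zero_divisor_ugraph R (S_tc1 0 n \<union> S_tc2 n)) = enat 2"
    (is "clique_number ?G = _")
proof (rule clique_number_eqI)
  let ?E = "tc_mat 0 1 :: complex^2^2" and ?F = "mat2 0 0 0 1 :: complex^2^2"
  have "?E \<noteq> ?F"
    by (simp add: tc_mat_def mat2_eq_iff)
  then show "card {?E, ?F} = 2"
    by simp
  have vertices: "?E \<in> S_tc1 0 n" "?F \<in> S_tc2 n"
    using tc_mat_1_in_S_tc1[OF assms(2)] assms(2) by (auto simp: S_tc2_def intro!: exI[of _ 1])
  have "?F \<in> matrices2 \<int>"
    by (simp add: mat2_in_matrices2_iff)
  then have "?E \<in> matrices2 R - {0}" "?F \<in> matrices2 R - {0}"
    using vertices(1) S_tc1_subset_matrices2[OF assms(1) Ints_0] matrices2_mono[OF assms(1)]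
    by auto
  moreover have "?E ** ?F = 0"
    by (simp add: tc_mat_def mat2_mult)
  ultimately show "is_clique ?G {?E, ?F}"
    using vertices by (auto simp: is_clique_def adj_zero_divisor_ugraph_iff)
next
  fix D assume D: "is_clique ?G D"
  then have "card D \<le> card {S_tc1 0 n, S_tc2 n}"
    by (rule card_clique_le_card_independent_cover)
      (use D in \<open>auto simp: is_clique_def is_independent_S_tc1 is_independent_S_tc2\<close>)
  also have "\<dots> \<le> 2"
    by (simp add: card_insert_if)
  finally show "card D \<le> 2" .
qed simp

lemma card_clique_le_if_cube_eq_minus_1:
  assumes C: "finite C" "is_clique (zero_divisor_ugraph R (\<Union>t\<in>U. S_tc1 t n)) C"
    and t: "t^3 = -1" and A: "A \<in> C \<inter> S_tc1 t n"
  shows "card C \<le> 2 * n + 1"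
proof -
  let ?G = "zero_divisor_ugraph R (\<Union>t\<in>U. S_tc1 t n)"
  have "C \<subseteq> S_tc1 t n \<union> (C \<inter> S_tc1 (-t) n)"
  proof
    fix B assume "B \<in> C"
    then obtain s where s: "B \<in> S_tc1 s n"
      using C(2) unfolding is_clique_def by auto
    show "B \<in> S_tc1 t n \<union> (C \<inter> S_tc1 (-t) n)"
    proof (cases "A = B")
      case False
      then have "(A, B) \<in> arcs_ends ?G"
        using C(2) A \<open>B \<in> C\<close> unfolding is_clique_def by blast
      then have "t * s^2 = -1 \<or> s * t^2 = -1"
        using A s by (intro adj_S_tc1D) auto
      then have "s = t \<or> s = -t"
        using t by (intro eq_or_eq_minus_if_mult_square_eq) auto
      then show ?thesis
        using \<open>B \<in> C\<close> s by auto
    qed (use A in auto)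
  qed
  then have "card C \<le> card (S_tc1 t n \<union> (C \<inter> S_tc1 (-t) n))"
    using C(1) by (intro card_mono) (auto simp: finite_S_tc1)
  also have "\<dots> \<le> card (S_tc1 t n) + card (C \<inter> S_tc1 (-t) n)"
    by (rule card_Un_le)
  also have "\<dots> \<le> 2 * n + 1"
    using card_clique_Int_independent_le_1[OF C(2) is_independent_S_tc1[of "-t"]] t
    by (simp add: card_S_tc1)
  finally show ?thesis .
qed

lemma card_clique_le_if_cubes_neq_minus_1:
  assumes C: "is_clique (zero_divisor_ugraph R (\<Union>t\<in>U. S_tc1 t n)) C"
    and disjoint: "\<And>t. t^3 = -1 \<Longrightarrow> C \<inter> S_tc1 t n = {}"
    and finite: "finite {t \<in> U. t^3 \<noteq> -1}"
  shows "card C \<le> card {t \<in> U. t^3 \<noteq> -1}"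
proof -
  let ?\<I> = "(\<lambda>t. S_tc1 t n) ` {t \<in> U. t^3 \<noteq> -1}"
  have "C \<subseteq> (\<Union>t\<in>U. S_tc1 t n)"
    using C by (simp add: is_clique_def)
  then have "C \<subseteq> \<Union>?\<I>"
    using disjoint by blast
  then have "card C \<le> card ?\<I>"
    using C finite by (intro card_clique_le_card_independent_cover) (auto simp: is_independent_S_tc1)
  also have "\<dots> \<le> card {t \<in> U. t^3 \<noteq> -1}"
    using finite by (rule card_image_le)
  finally show ?thesis .
qed

lemma is_clique_insert_S_tc1:
  assumes "\<int> \<subseteq> R" "1 \<in> U" "-1 \<in> U" "n \<ge> 1"
  shows "is_clique (zero_divisor_ugraph R (\<Union>t\<in>U. S_tc1 t n)) (insert (tc_mat 1 1) (S_tc1 (-1) n))"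
    (is "is_clique _ ?C")
proof -
  have E: "tc_mat 1 1 \<in> S_tc1 1 n"
    using assms(4) by (rule tc_mat_1_in_S_tc1)
  then have "?C \<subseteq> (\<Union>t\<in>U. S_tc1 t n)"
    using assms(2,3) by blast
  moreover have "?C \<subseteq> matrices2 R - {0}"
    using E S_tc1_subset_matrices2[OF assms(1)] by (meson Ints_1 Ints_minus insert_subset subsetD)
  moreover have "A ** B = 0" if "A \<in> S_tc1 (-1) n" "B \<in> ?C" for A B
    using that E by (auto simp: S_tc1_mult_eq_0_iff)
  ultimately show ?thesis
    unfolding is_clique_def verts_zero_divisor_ugraph adj_zero_divisor_ugraph_iff by blast
qed

lemma clique_number_UN_S_tc1:
  assumes "\<int> \<subseteq> R" "n \<ge> 1" "1 \<in> U" "-1 \<in> U"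
    and "finite {t \<in> U. t^3 \<noteq> -1}" "card {t \<in> U. t^3 \<noteq> -1} \<le> 2 * n + 1"
  shows "clique_number (zero_divisor_ugraph R (\<Union>t\<in>U. S_tc1 t n)) = enat (2 * n + 1)"
    (is "clique_number ?G = _")
proof (rule clique_number_eqI)
  let ?C = "insert (tc_mat 1 1) (S_tc1 (-1) n)"
  show "is_clique ?G ?C"
    using assms(1,3,4,2) by (rule is_clique_insert_S_tc1)
  show "finite ?C"
    by (simp add: finite_S_tc1)
  have "tc_mat 1 1 \<notin> S_tc1 (-1) n"
    using disjoint_S_tc1[of 1 "-1" n n] tc_mat_1_in_S_tc1[OF assms(2)] by force
  then show "card ?C = 2 * n + 1"
    by (simp add: finite_S_tc1 card_S_tc1)
next
  fix D assume D: "finite D" "is_clique ?G D"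
  show "card D \<le> 2 * n + 1"
  proof (cases "\<exists>t. t^3 = -1 \<and> D \<inter> S_tc1 t n \<noteq> {}")
    case True
    then show ?thesis
      using card_clique_le_if_cube_eq_minus_1[OF D] by blast
  next
    case False
    then have "card D \<le> card {t \<in> U. t^3 \<noteq> -1}"
      using D(2) assms(5) by (intro card_clique_le_if_cubes_neq_minus_1) auto
    then show ?thesis
      using assms(6) by (rule order_trans)
  qed
qed

lemma card_U_set_cube_neq_le:
  assumes "\<zeta>^3 = 1"
  shows "card {t \<in> U_set d \<zeta>. t^3 \<noteq> -1} \<le> 3"
proof -
  let ?V = "if d = 1 then {1, \<i>, - \<i>} else {1, \<zeta>, \<zeta>^2}"
  have "(\<zeta>^2)^3 = (\<zeta>^3)^2"
    by (simp flip: power_mult)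
  then have "(- \<zeta>)^3 = -1" "(- (\<zeta>^2))^3 = -1"
    using assms by simp_all
  then have "{t \<in> U_set d \<zeta>. t^3 \<noteq> -1} \<subseteq> ?V"
    by (auto simp: U_set_def)
  then have "card {t \<in> U_set d \<zeta>. t^3 \<noteq> -1} \<le> card ?V"
    by (rule card_mono[rotated]) simp
  also have "\<dots> \<le> 3"
    using card_length[of "[1, \<i>, - \<i>]"] card_length[of "[1, \<zeta>, \<zeta>^2]"] by simp
  finally show ?thesis .
qed

theorem theorem3p19:
  fixes d :: nat and \<zeta> :: complex
  assumes "d = 0 \<or> (d > 0 \<and> squarefree d)"
    and "primitive_root_unity 3 \<zeta>"
  shows "(\<forall>n::nat. n \<ge> 1 \<longrightarrow> clique_number (with_proj (mk_symmetric (Gamma1 d n))) = 2) \<and>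
         (\<forall>n::nat. n \<ge> 1 \<longrightarrow>
            clique_number (with_proj (mk_symmetric (Gamma2 d \<zeta> n))) = enat (2 * n + 1))"
proof (intro conjI allI impI)
  fix n :: nat assume n: "n \<ge> 1"
  have Ints: "\<int> \<subseteq> ring_of_integers (imag_quadratic_field d)"
    by (rule Ints_subset_ring_of_integers[OF is_subfield_imag_quadratic_field])
  show "clique_number (with_proj (mk_symmetric (Gamma1 d n))) = 2"
    using clique_number_S_tc1_0_Un_S_tc2[OF Ints n]
    by (simp add: Gamma1_def zero_divisor_ugraph_def numeral_eq_enat)
  have "\<zeta>^3 = 1"
    using assms(2) by (simp add: primitive_root_unity_def)
  then have "card {t \<in> U_set d \<zeta>. t^3 \<noteq> -1} \<le> 2 * n + 1"
    using card_U_set_cube_neq_le[of \<zeta> d] n by simp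
  then show "clique_number (with_proj (mk_symmetric (Gamma2 d \<zeta> n))) = enat (2 * n + 1)"
    using clique_number_UN_S_tc1[OF Ints n, of "U_set d \<zeta>"]
    by (simp add: U_set_def Gamma2_def zero_divisor_ugraph_def)
qed

end
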